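(* Let $u>r\ge 2$ be integers and $Q=(u,u-r)$. For all integers $k,l$ with $1\le k\le r-1$ and $1\le l\le u-r$, the partition $P_{k,l}(Q)$ in the table $\mathcal T(Q)$ is identical with the partition $P^Q_{k,l}$ whose Burge code is $$\alpha^{u-r-l}\,\beta^{l}\,\alpha^{r-k}\,\beta^{k}\,\alpha .$$
   Context: **The table $\mathcal T(Q)$.** For integers $n\ge m\ge1$, $[n]^m$ denotes the unique partition of $n$ into $m$ parts whose largest and smallest parts differ by at most one. A list such as $([n]^m,[n']^{m'})$ denotes the partition whose multiset of parts is the union, and $q^{d}$ denotes $d$ parts equal to $q$. Let $t_{\max}=\min\{u-r,\lfloor\frac{r-1}{2}\rfloor\}$ and $T=t_{\max}+1$. Put $k_0=1$, and for $1\le t\le t_{\max}$ put $$q_t=\Big\lceil\frac{u-r}{t}\Big\rceil,\quad d_t=tq_t-(u-r),\quad k_t=t+1+\Big\lfloor\frac{r-2t}{q_t+1}\Big\rfloor,\quad c_t=\begin{cases}t+\big\lceil\frac{r-2t}{q_t}\big\rceil & d_t>0,\\ k_t& d_t=0.\end{cases}$$ Define, for $1\le t\le t_{\max}$, - $A_t=\{(k,l): k_{t-1}\le k<k_t,\ t\le l\le u-r\}$, - $C_t=\{(k,t): k_t\le k<c_t\}$, - $B_t=\{(k,t): c_t\le k\le r-t\}\cup\{(r-t,l): t<l\le u-r\}$, and $A_T=\{(k,l): k=k_{t_{\max}}=r-T,\ T\le l\le u-r\}$ (empty if $k_{t_{\max}}\ne r-T$). Every pair $(k,l)$ with $1\le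 k\le r-1$, $1\le l\le u-r$ lies in exactly one of these sets, and $P_{k,l}(Q)$ is defined by - $P_{k,l}(Q)=([u]^k,[u-r]^l)$ if $(k,l)\in A_t$, $1\le t\le T$; - $P_{k,l}(Q)=\big([u-r+2t]^t,[u-2t-d_t(q_t-1)]^{k-d_t},(q_t-1)^{d_t}\big)$ if $(k,l)\in C_t$; - $P_{k,l}(Q)=\big([u-r+2t]^t,[u-2t]^{k+l-t}\big)$ if $(k,l)\in B_t$. **Burge code.** For a nonempty partition $P$, choose parts greedily from the top: $i_1$ is the largest part of $P$, and, given $i_j$, $i_{j+1}$ is the largest part of $P$ that is at most $i_j-2$, as long as such a part exists. Let $\partial P$ be obtained from $P$ by replacing, for each chosen value $i_j$, exactly one part equal to $i_j$ by $i_j-1$ (discarding a resulting part $0$). The letter attached to $P$ is $\beta$ if some chosen value equals $1$ (so that a part is removed), and $\alpha$ otherwise. The Burge code of $P$ is the word in $\alpha,\beta$ obtained by writing from left to right the letters attached to $P,\partial P,\partial^2P,\dots$ until the empty partition is reached, followed by one final letter $\alpha$. A partition is uniquely determined by its Burge code. For example, $(5,2)$ has Burge code $\alpha\beta\alpha^2\beta\alpha$. *)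

theory Defs
  imports Complex_Main "HOL-Library.Multiset"
begin

section \<open>Partitions\<close>

text \<open>A partition is the finite multiset of its parts, all of which are positive.\<close>

definition is_partition :: "nat multiset \<Rightarrow> bool" where
  "is_partition P \<longleftrightarrow> 0 \<notin># P"

text \<open>\<open>almost_equal n m\<close> is $[n]^m$; it is only meaningful for \<open>1 \<le> m \<le> n\<close>.\<close>

definition almost_equal :: "nat \<Rightarrow> nat \<Rightarrow> nat multiset" where
  "almost_equal n m =
    (THE P. is_partition P \<and> sum_mset P = n \<and> size P = m \<and> Max_mset P - Min_mset P \<le> 1)"

section \<open>The table of a partition with two parts\<close>

text \<open>
  Throughout, \<open>u > r \<ge> 2\<close> and $Q = (u, u-r)$. For these parameters, for
  \<open>1 \<le> t \<le> t_max u r\<close>, and for the entries of the table, none of the subtractions on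
  natural numbers below truncates, and \<open>div\<close> is the floor of the quotient.
\<close>

definition t_max :: "nat \<Rightarrow> nat \<Rightarrow> nat" where
  "t_max u r = min (u - r) ((r - 1) div 2)"

definition q_t :: "nat \<Rightarrow> nat \<Rightarrow> nat \<Rightarrow> nat" where
  "q_t u r t = nat \<lceil>real (u - r) / real t\<rceil>"

definition d_t :: "nat \<Rightarrow> nat \<Rightarrow> nat \<Rightarrow> nat" where
  "d_t u r t = t * q_t u r t - (u - r)"

definition k_t :: "nat \<Rightarrow> nat \<Rightarrow> nat \<Rightarrow> nat" where
  "k_t u r t = (if t = 0 then 1 else t + 1 + (r - 2 * t) div (q_t u r t + 1))"

definition c_t :: "nat \<Rightarrow> nat \<Rightarrow> nat \<Rightarrow> nat" where
  "c_t u r t =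
    (if d_t u r t > 0 then t + nat \<lceil>real (r - 2 * t) / real (q_t u r t)\<rceil> else k_t u r t)"

definition A_set :: "nat \<Rightarrow> nat \<Rightarrow> nat \<Rightarrow> (nat \<times> nat) set" where
  "A_set u r t =
    (if t = t_max u r + 1
     then {(k, l). k = k_t u r (t_max u r) \<and> k = r - t \<and> t \<le> l \<and> l \<le> u - r}
     else {(k, l). k_t u r (t - 1) \<le> k \<and> k < k_t u r t \<and> t \<le> l \<and> l \<le> u - r})"

definition C_set :: "nat \<Rightarrow> nat \<Rightarrow> nat \<Rightarrow> (nat \<times> nat) set" where
  "C_set u r t = {(k, l). l = t \<and> k_t u r t \<le> k \<and> k < c_t u r t}"

definition B_set :: "nat \<Rightarrow> nat \<Rightarrow> nat \<Rightarrow> (nat \<times> nat) set" where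
  "B_set u r t =
    {(k, l). l = t \<and> c_t u r t \<le> k \<and> k \<le> r - t} \<union>
    {(k, l). k = r - t \<and> t < l \<and> l \<le> u - r}"

inductive is_table_entry :: "nat \<Rightarrow> nat \<Rightarrow> nat \<Rightarrow> nat \<Rightarrow> nat multiset \<Rightarrow> bool"
  for u r k l :: nat where
  A: "is_table_entry u r k l (almost_equal u k + almost_equal (u - r) l)"
    if "1 \<le> t" "t \<le> t_max u r + 1" "(k, l) \<in> A_set u r t"
| C: "is_table_entry u r k l
        (almost_equal (u - r + 2 * t) t
          + almost_equal (u - 2 * t - d_t u r t * (q_t u r t - 1)) (k - d_t u r t)
          + replicate_mset (d_t u r t) (q_t u r t - 1))"
    if "1 \<le> t" "t \<le> t_max u r" "(k, l) \<in> C_set u r t"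
| B: "is_table_entry u r k l
        (almost_equal (u - r + 2 * t) t + almost_equal (u - 2 * t) (k + l - t))"
    if "1 \<le> t" "t \<le> t_max u r" "(k, l) \<in> B_set u r t"

text \<open>
  \<open>table_partition u r k l\<close> is $P_{k,l}(Q)$. The description is proper because every \<open>(k, l)\<close>
  with \<open>1 \<le> k \<le> r - 1\<close> and \<open>1 \<le> l \<le> u - r\<close> lies in exactly one of the sets above.
\<close>

definition table_partition :: "nat \<Rightarrow> nat \<Rightarrow> nat \<Rightarrow> nat \<Rightarrow> nat multiset" where
  "table_partition u r k l = (THE P. is_table_entry u r k l P)"

section \<open>The Burge code\<close>

text \<open>The values chosen greedily from the top, in decreasing order.\<close>

function burge_chain :: "nat multiset \<Rightarrow> nat list" where
  "burge_chain P =
    (if P = {#} then []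
     else Max_mset P # burge_chain {#j \<in># P. j + 2 \<le> Max_mset P#})"
  by auto
termination
proof (relation "measure size")
  fix P :: "nat multiset"
  assume "P \<noteq> {#}"
  then have "Max_mset P \<in># P" by simp
  then have "{#j \<in># P. j + 2 \<le> Max_mset P#} \<subset># P"
    by (metis add_2_eq_Suc' filter_mset_eq_conv multiset_filter_subset not_less_eq_eq
        le_SucI order_refl subset_mset.le_imp_less_or_eq)
  then show "({#j \<in># P. j + 2 \<le> Max_mset P#}, P) \<in> measure size"
    by (simp add: mset_subset_size)
qed simp

declare burge_chain.simps [simp del]

definition burge_step :: "nat multiset \<Rightarrow> nat multiset" where
  "burge_step P =
    {#i \<in># (P - mset (burge_chain P)) + image_mset (\<lambda>i. i - 1) (mset (burge_chain P)). i > 0#}"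

datatype letter = \<alpha> | \<beta>

definition burge_letter :: "nat multiset \<Rightarrow> letter" where
  "burge_letter P = (if 1 \<in> set (burge_chain P) then \<beta> else \<alpha>)"

lemma burge_chain_subset: "mset (burge_chain P) \<subseteq># P"
proof (induction P rule: burge_chain.induct)
  case (1 P)
  show ?case
  proof (cases "P = {#}")
    case True
    then show ?thesis by (simp add: burge_chain.simps)
  next
    case False
    let ?F = "{#j \<in># P. j + 2 \<le> Max_mset P#}"
    have "?F \<subseteq># P - {#Max_mset P#}"
      by (rule mset_subset_eqI) (auto simp: count_filter_mset)
    with 1[OF False] have "mset (burge_chain ?F) \<subseteq># P - {#Max_mset P#}"
      by (rule subset_mset.order_trans)
    with False have "add_mset (Max_mset P) (mset (burge_chain ?F)) \<subseteq># P"
      by (simp add: insert_subset_eq_iff)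
    with False show ?thesis by (subst burge_chain.simps) simp
  qed
qed

lemma burge_step_decreasing:
  assumes "P \<noteq> {#}"
  shows "sum_mset (burge_step P) + size (burge_step P) < sum_mset P + size P"
proof -
  define C where "C = mset (burge_chain P)"
  define w where "w = (\<lambda>M :: nat multiset. \<Sum>i\<in>#M. if i = 0 then 0 else i + 1)"
  have w_le: "w M \<le> sum_mset M + size M" for M
    by (induction M) (auto simp: w_def)
  have w_filter: "sum_mset {#i \<in># M. i > 0#} + size {#i \<in># M. i > 0#} = w M" for M
    by (induction M) (auto simp: w_def)
  have w_pred: "w (image_mset (\<lambda>i. i - 1) M) \<le> sum_mset M" for M
    by (induction M) (auto simp: w_def)
  have w_union: "w (M + N) = w M + w N" for M N
    by (simp add: w_def)
  have split: "P = (P - C) + C"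
    using burge_chain_subset[of P] by (simp add: C_def)
  have "C \<noteq> {#}"
    using assms by (simp add: C_def burge_chain.simps[of P])
  then have "size C > 0" by (simp add: nonempty_has_size)
  have "sum_mset (burge_step P) + size (burge_step P)
      = w (P - C) + w (image_mset (\<lambda>i. i - 1) C)"
    unfolding burge_step_def w_filter by (simp add: w_union C_def)
  also have "\<dots> \<le> (sum_mset (P - C) + size (P - C)) + sum_mset C"
    using w_le w_pred by (rule add_mono)
  also have "\<dots> < sum_mset (P - C) + size (P - C) + (sum_mset C + size C)"
    using \<open>size C > 0\<close> by simp
  also have "\<dots> = sum_mset ((P - C) + C) + size ((P - C) + C)"
    by (simp only: sum_mset.union size_union)
  finally show ?thesis using split by simp
qed

function burge_code :: "nat multiset \<Rightarrow> letter list" where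
  "burge_code P = (if P = {#} then [\<alpha>] else burge_letter P # burge_code (burge_step P))"
  by auto
termination
  by (relation "measure (\<lambda>P. sum_mset P + size P)") (auto simp: burge_step_decreasing)

declare burge_code.simps [simp del]

lemma "burge_code {#5, 2#} = [\<alpha>, \<beta>, \<alpha>, \<alpha>, \<beta>, \<alpha>]"
  by code_simp

text \<open>A partition is determined by its Burge code, so at most one \<open>P\<close> is described here.\<close>

definition burge_partition :: "letter list \<Rightarrow> nat multiset" where
  "burge_partition w = (THE P. is_partition P \<and> burge_code P = w)"

end

theory Submission
  imports Defs
begin

text \<open>
  The operation $\partial$ behaves like the time evolution of a box-ball system. Almost equal
  parts $[n]^m$ are a single soliton, which $\partial$ turns into $[n-1]^m$; its top part loses
  one every \<open>m\<close> steps. Write \<open>s = u - r\<close> and let \<open>s\<close> decrease for fixed \<open>k\<close>, \<open>r\<close>, \<open>l\<close>. Two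
  solitons with well-separated top parts move independently, which settles the shapes of the
  sets \<open>A\<close> and \<open>B\<close> away from a collision. If \<open>l = t < k\<close>, the shape of \<open>B\<close> collides: the
  configuration of \<open>C\<close> lasts for one period of \<open>t\<close> steps and then leaves as the shape of \<open>A\<close>, with
  a shift of \<open>2 * t\<close> units from one soliton to the other. The diagonal \<open>s = l\<close>, where
  $\partial$ starts to remove parts, is the start of the induction on \<open>s\<close>.

  Both the uniqueness of the partition with a given code and the fact that the table is well defined
  come from injectivity of the Burge code.
\<close>

section \<open>Injectivity of the Burge code\<close>

lemma burge_chain_empty_iff [simp]: "burge_chain P = [] \<longleftrightarrow> P = {#}"
  by (simp add: burge_chain.simps[of P])

lemma burge_chain_empty [simp]: "burge_chain {#} = []"
  by simp

lemma burge_chain_Cons: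
  assumes "M \<in># P" and "\<And>p. p \<in># P \<Longrightarrow> p \<le> M"
  shows "burge_chain P = M # burge_chain {#j \<in># P. j + 2 \<le> M#}"
proof -
  have "Max_mset P = M"
    using assms by (intro Max_eqI) auto
  with assms(1) show ?thesis
    by (subst burge_chain.simps) auto
qed

text \<open>A one-element chain means that all parts of \<open>X\<close> are \<open>M\<close> or
  \<open>M - 1\<close>. Choosing \<open>M\<close> discards exactly these, and the greedy choice
  continues in \<open>Y\<close> as if \<open>X\<close> were absent.\<close>

lemma burge_chain_union:
  assumes "burge_chain X = [M]" and "\<And>y. y \<in># Y \<Longrightarrow> y + 2 \<le> M"
  shows "burge_chain (X + Y) = M # burge_chain Y"
proof -
  have "X \<noteq> {#}"
    using assms(1) by auto
  have M: "Max_mset X = M" and F: "{#j \<in># X. j + 2 \<le> M#} = {#}"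
    using assms(1) \<open>X \<noteq> {#}\<close> by (auto simp: burge_chain.simps[of X])
  have "M \<in># X" and "\<And>x. x \<in># X \<Longrightarrow> x \<le> M"
    using \<open>X \<noteq> {#}\<close> M by (auto simp flip: M)
  then have "burge_chain (X + Y) = M # burge_chain {#j \<in># X + Y. j + 2 \<le> M#}"
    using assms(2) by (intro burge_chain_Cons) fastforce+
  also have "{#j \<in># X + Y. j + 2 \<le> M#} = Y"
    using F filter_mset_True[of Y] assms(2) by (metis (no_types, lifting) add_0 filter_mset_cong filter_union_mset)
  finally show ?thesis .
qed

lemma burge_step_union:
  assumes "burge_chain (X + Y) = burge_chain X @ burge_chain Y"
  shows "burge_step (X + Y) = burge_step X + burge_step Y"
proof -
  have "X + Y - (mset (burge_chain X) + mset (burge_chain Y)) =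
    (X - mset (burge_chain X)) + (Y - mset (burge_chain Y))"
    using burge_chain_subset[of X] burge_chain_subset[of Y]
    by (auto simp: multiset_eq_iff subseteq_mset_def)
  then show ?thesis
    by (simp add: burge_step_def assms)
qed

lemma in_burge_chain_imp_in: "i \<in> set (burge_chain P) \<Longrightarrow> i \<in># P"
  using burge_chain_subset[of P] by (metis mset_subset_eqD set_mset_mset)

text \<open>Together with \<open>burge_chain_covers\<close> this is all that injectivity needs from
  greediness: chosen values are at least 2 apart, and a value can be skipped only because its
  successor was chosen.\<close>

lemma burge_chain_distinct_gap:
  "distinct (burge_chain P) \<and> (\<forall>i \<in> set (burge_chain P). Suc i \<notin> set (burge_chain P))"
proof (induction P rule: burge_chain.induct)
  case (1 P)
  show ?case
  proof (cases "P = {#}")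
    case False
    let ?F = "{#j \<in># P. j + 2 \<le> Max_mset P#}"
    have small: "i + 2 \<le> Max_mset P" if "i \<in> set (burge_chain ?F)" for i
      using in_burge_chain_imp_in[OF that] by simp
    have "burge_chain P = Max_mset P # burge_chain ?F"
      using False by (subst burge_chain.simps) simp
    then show ?thesis
      using 1[OF False] small by fastforce
  qed simp
qed

lemma burge_chain_covers:
  "p \<in># P \<Longrightarrow> p \<in> set (burge_chain P) \<or> Suc p \<in> set (burge_chain P)"
proof (induction P rule: burge_chain.induct)
  case (1 P)
  let ?F = "{#j \<in># P. j + 2 \<le> Max_mset P#}"
  have "P \<noteq> {#}"
    using 1(2) by auto
  then have eq: "burge_chain P = Max_mset P # burge_chain ?F"
    by (subst burge_chain.simps) simp
  have "p \<le> Max_mset P"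
    using 1(2) by simp
  then consider "p + 2 \<le> Max_mset P" | "p = Max_mset P" | "Suc p = Max_mset P"
    by linarith
  then show ?case
  proof cases
    case 1
    then show ?thesis
      using "1.IH"[OF \<open>P \<noteq> {#}\<close>] \<open>p \<in># P\<close> by (auto simp: eq)
  qed (auto simp: eq)
qed

lemma is_partition_burge_step: "is_partition (burge_step P)"
  by (auto simp: is_partition_def burge_step_def simp del: filter_diff_mset filter_union_mset)

text \<open>The step before zeros are discarded. Keeping the zero makes the step reversible, and the
  zero carries the same information as the letter.\<close>

definition raw_step :: "nat multiset \<Rightarrow> nat multiset" where
  "raw_step P = P - mset (burge_chain P) + image_mset (\<lambda>i. i - 1) (mset (burge_chain P))"

lemma raw_step_eq:
  assumes "is_partition P"
  shows "raw_step P = burge_step P + (if burge_letter P = \<beta> then {#0#} else {#})"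
proof -
  have pos: "0 \<notin> set (burge_chain P)"
    using assms in_burge_chain_imp_in by (auto simp: is_partition_def)
  have "count (image_mset (\<lambda>i. i - 1) (mset xs)) 0 = (if 1 \<in> set xs then 1 else 0)"
    if "distinct xs" "0 \<notin> set xs" for xs :: "nat list"
    using that
  proof (induction xs)
    case (Cons a xs)
    then show ?case by (cases "a = 1") auto
  qed simp
  with pos have "count (raw_step P) 0 = (if burge_letter P = \<beta> then 1 else 0)"
    using burge_chain_distinct_gap[of P] assms
    by (auto simp: raw_step_def burge_letter_def is_partition_def not_in_iff)
  moreover have "burge_step P = {#i \<in># raw_step P. i > 0#}"
    by (simp add: burge_step_def raw_step_def)
  ultimately show ?thesis
    by (auto simp: multiset_eq_iff)
qed

text \<open>Chains are recovered from small values upwards. If only \<open>P\<close> chooses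
  \<open>i\<close>, the resulting \<open>i - 1\<close> must already be a part of \<open>P'\<close>.
  It is not blocked by \<open>i\<close> there, so \<open>P'\<close> chooses \<open>i - 1\<close>; by
  agreement below \<open>i\<close> so does \<open>P\<close>, which violates the gap.\<close>

lemma burge_chain_set_le:
  assumes "is_partition P" and "is_partition P'" and "raw_step P = raw_step P'"
  assumes same: "\<And>j. j < i \<Longrightarrow> j \<in> set (burge_chain P) \<longleftrightarrow> j \<in> set (burge_chain P')"
    and "i \<in> set (burge_chain P)"
  shows "i \<in> set (burge_chain P')"
proof (rule ccontr)
  assume "i \<notin> set (burge_chain P')"
  have "i > 0"
    using assms(1) in_burge_chain_imp_in[OF assms(5)] by (cases i) (auto simp: is_partition_def)
  have "i - 1 \<in># raw_step P"
    using assms(5) by (auto simp: raw_step_def)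
  then have "i - 1 \<in># P' - mset (burge_chain P') \<or> (\<exists>j \<in> set (burge_chain P'). i - 1 = j - 1)"
    unfolding assms(3) by (auto simp: raw_step_def)
  moreover have "j = i" if "j \<in> set (burge_chain P')" "i - 1 = j - 1" for j
  proof -
    \<comment> \<open>Since \<open>0 - 1 = 0\<close> on natural numbers, equality of predecessors
      identifies only positive values.\<close>
    have "j \<noteq> 0"
      using in_burge_chain_imp_in[OF that(1)] assms(2) by (metis is_partition_def)
    with that(2) \<open>i > 0\<close> show ?thesis by simp
  qed
  ultimately have "i - 1 \<in># P'"
    using \<open>i \<notin> _\<close> by (auto dest: in_diffD)
  then have "i - 1 \<in> set (burge_chain P')"
    using burge_chain_covers[of "i - 1" P'] \<open>i \<notin> _\<close> \<open>i > 0\<close> by simp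
  with same[of "i - 1"] \<open>i > 0\<close> have "i - 1 \<in> set (burge_chain P)"
    by simp
  with burge_chain_distinct_gap[of P] \<open>i > 0\<close> assms(5) show False
    by (metis Suc_diff_1)
qed

lemma raw_step_inj:
  assumes "is_partition P" and "is_partition P'" and "raw_step P = raw_step P'"
  shows "P = P'"
proof -
  have "i \<in> set (burge_chain P) \<longleftrightarrow> i \<in> set (burge_chain P')" for i
  proof (induction i rule: less_induct)
    case (less i)
    then show ?case
      using burge_chain_set_le[OF assms] burge_chain_set_le[OF assms(2,1) assms(3)[symmetric]]
      by blast
  qed
  then have "mset (burge_chain P) = mset (burge_chain P')"
    using burge_chain_distinct_gap by (subst set_eq_iff_mset_eq_distinct[symmetric]) auto
  with assms(3) have "P - mset (burge_chain P) = P' - mset (burge_chain P)"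
    by (simp add: raw_step_def)
  then show ?thesis
    using burge_chain_subset[of P] burge_chain_subset[of P'] \<open>mset (burge_chain P) = _\<close>
    by (metis subset_mset.diff_add)
qed

text \<open>The tail of the code determines \<open>burge_step P\<close> by induction; the first
  letter restores the zero, and \<open>raw_step\<close> can be undone.\<close>

lemma burge_code_inj:
  assumes "is_partition P" and "is_partition P'" and "burge_code P = burge_code P'"
  shows "P = P'"
  using assms
proof (induction P arbitrary: P' rule: burge_code.induct)
  case (1 P)
  \<comment> \<open>The empty partition has a code of length one, every other partition a longer
    one, so the closing \<alpha> cannot be mistaken for a step.\<close>
  have nonempty: "burge_code R \<noteq> []" for R
    by (subst burge_code.simps) simp
  show ?case
  proof (cases "P = {#} \<or> P' = {#}")
    case True
    with 1(4) nonempty nonempty[symmetric] show ?thesis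
      by (auto simp: burge_code.simps[of P] burge_code.simps[of P'] split: if_splits)
  next
    case False
    with 1(4) have "burge_letter P = burge_letter P'"
      and "burge_code (burge_step P) = burge_code (burge_step P')"
      by (auto simp: burge_code.simps[of P] burge_code.simps[of P'])
    moreover from this False have "burge_step P = burge_step P'"
      by (intro 1(1) is_partition_burge_step) auto
    ultimately have "raw_step P = raw_step P'"
      using 1(2,3) by (simp add: raw_step_eq)
    with 1(2,3) show ?thesis
      by (rule raw_step_inj)
  qed
qed

section \<open>Almost equal parts\<close>

text \<open>A closed form to calculate with in place of the definite description
  \<open>almost_equal\<close>. Its value at \<open>n = m = 0\<close> is empty, so inductions can run
  down to the empty partition.\<close>

definition balanced :: "nat \<Rightarrow> nat \<Rightarrow> nat multiset" where
  "balanced n m = replicate_mset (n mod m) (n div m + 1) + replicate_mset (m - n mod m) (n div m)"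

text \<open>The remainder \<open>a = m\<close> is allowed. With \<open>1 \<le> a\<close>, as in
  \<open>balanced_cases\<close>, \<open>p + 1\<close> is the true largest part even if
  \<open>m\<close> divides the total.\<close>

lemma balanced_eq:
  assumes "a \<le> m"
  shows "balanced (m * p + a) m = replicate_mset a (p + 1) + replicate_mset (m - a) p"
proof (cases "a = m")
  case True
  then have "m * p + a = m * (p + 1)" by simp
  then show ?thesis
    using True by (cases "m = 0") (auto simp: balanced_def simp del: mult_Suc_right)
next
  case False
  with assms have "(m * p + a) div m = p" "(m * p + a) mod m = a"
    by auto
  then show ?thesis
    by (simp add: balanced_def)
qed

lemma balanced_0_0 [simp]: "balanced 0 0 = {#}"
  by (simp add: balanced_def)

lemma balanced_cases:
  fixes m n :: nat
  assumes "1 \<le> m" and "1 \<le> n"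
  obtains p a where "n = m * p + a" and "1 \<le> a" and "a \<le> m"
proof
  show "n = m * ((n - 1) div m) + ((n - 1) mod m + 1)"
    using assms(2) mult_div_mod_eq[of m "n - 1"] by linarith
  show "(n - 1) mod m + 1 \<le> m"
    using assms by (simp add: Suc_leI)
qed simp

section \<open>The Burge step on a single block of almost equal parts\<close>

lemma filter_replicate_mset:
  "filter_mset Q (replicate_mset n x) = (if Q x then replicate_mset n x else {#})"
  by (induction n) auto

lemma burge_chain_replicate:
  assumes "1 \<le> a"
  shows "burge_chain (replicate_mset a (p + 1) + replicate_mset b p) = [p + 1]"
  using assms by (subst burge_chain_Cons[of "p + 1"]) (auto simp: filter_mset_eq_conv split: if_splits)

text \<open>Only one largest part is chosen, since the others are at most one smaller and equal
  values are chosen once. Lowering it keeps the block balanced; for \<open>n = m\<close> all parts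
  are 1 and one disappears.\<close>

lemma
  assumes "1 \<le> m" and "m \<le> n"
  shows burge_chain_balanced: "burge_chain (balanced n m) = [(n - 1) div m + 1]"
    and burge_step_balanced: "burge_step (balanced n m) =
      balanced (n - 1) (if n = m then m - 1 else m)"
proof -
  from assms have "1 \<le> n" by simp
  with assms(1) obtain p a where pa: "n = m * p + a" "1 \<le> a" "a \<le> m"
    by (rule balanced_cases)
  then have P: "balanced n m = replicate_mset a (p + 1) + replicate_mset (m - a) p"
    by (simp add: balanced_eq)
  have chain: "burge_chain (balanced n m) = [p + 1]"
    using pa(2) by (simp add: P burge_chain_replicate[simplified])
  have "n - 1 = m * p + (a - 1)" "a - 1 < m"
    using pa by auto
  then have div: "(n - 1) div m = p"
    by simp
  with chain show "burge_chain (balanced n m) = [(n - 1) div m + 1]"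
    by simp
  have "replicate_mset a (p + 1) = add_mset (p + 1) (replicate_mset (a - 1) (p + 1))"
    using pa(2) by (metis Suc_diff_1 less_eq_Suc_le One_nat_def replicate_mset_Suc)
  then have step: "burge_step (balanced n m) = {#i \<in># replicate_mset (a - 1) (p + 1)
      + replicate_mset (m - a) p + {#p#}. i > 0#}"
    unfolding burge_step_def chain by (simp add: P)
  show "burge_step (balanced n m) = balanced (n - 1) (if n = m then m - 1 else m)"
  proof (cases "p = 0")
    case True
    with pa assms(2) have "n = m" "a = m" by auto
    moreover have "balanced (m - 1) (m - 1) = replicate_mset (m - 1) 1"
      using balanced_eq[of 0 "m - 1" 1] by simp
    ultimately show ?thesis
      using True step by (simp add: filter_replicate_mset)
  next
    case False
    then have "m \<le> m * p"
      by simp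
    with pa have "n \<noteq> m" by linarith
    have "balanced (n - 1) m = replicate_mset (a - 1) (p + 1) + replicate_mset (m - (a - 1)) p"
      unfolding \<open>n - 1 = _\<close> using pa by (intro balanced_eq) simp
    moreover have "m - (a - 1) = Suc (m - a)"
      using pa by simp
    ultimately show ?thesis
      using False \<open>n \<noteq> m\<close> pa(3) by (simp add: step filter_replicate_mset Suc_diff_le)
  qed
qed

lemma is_partition_balanced:
  assumes "1 \<le> m" and "m \<le> n"
  shows "is_partition (balanced n m)"
  using assms by (auto simp: is_partition_def balanced_def div_eq_0_iff split: if_splits)

lemma burge_letter_balanced:
  assumes "1 \<le> m" and "m \<le> n"
  shows "burge_letter (balanced n m) = (if n = m then \<beta> else \<alpha>)"
  using assms by (auto simp: burge_letter_def burge_chain_balanced div_eq_0_iff)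

lemma balanced_nonempty:
  assumes "1 \<le> m" and "m \<le> n"
  shows "balanced n m \<noteq> {#}"
  using burge_chain_balanced[OF assms] by auto

lemma burge_code_Cons:
  "P \<noteq> {#} \<Longrightarrow> burge_code P = burge_letter P # burge_code (burge_step P)"
  by (subst burge_code.simps) simp

lemma burge_code_balanced:
  assumes "m \<le> n" "m = 0 \<longrightarrow> n = 0"
  shows "burge_code (balanced n m) = replicate (n - m) \<alpha> @ replicate m \<beta> @ [\<alpha>]"
  using assms
proof (induction n arbitrary: m)
  case 0
  then show ?case by (simp add: burge_code.simps)
next
  case (Suc n)
  then have m: "1 \<le> m" "m \<le> Suc n" by auto
  note * = burge_code_Cons[OF balanced_nonempty[OF m]] burge_letter_balanced[OF m]
    burge_step_balanced[OF m]
  show ?case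
  proof (cases "m = Suc n")
    case True
    with Suc.IH[of n] * show ?thesis by simp
  next
    case False
    with m have "m \<le> n" by simp
    with Suc.IH[of m] m False * show ?thesis by (simp add: Suc_diff_le)
  qed
qed

lemma almost_equal_unique:
  assumes "1 \<le> m" and "is_partition P" and "sum_mset P = n" and "size P = m"
    and "Max_mset P - Min_mset P \<le> 1"
  shows "P = balanced n m"
proof -
  have "P \<noteq> {#}"
    using assms(1,4) by auto
  define \<mu> a where "\<mu> = Min_mset P" and "a = count P (\<mu> + 1)"
  have range: "x = \<mu> \<or> x = \<mu> + 1" if "x \<in># P" for x
  proof -
    have "Min_mset P \<le> x" "x \<le> Max_mset P"
      using that by auto
    with assms(5) show ?thesis unfolding \<mu>_def by linarith
  qed
  define b where "b = count P \<mu>"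
  have P: "P = replicate_mset a (\<mu> + 1) + replicate_mset b \<mu>"
    using range by (force simp: multiset_eq_iff a_def b_def not_in_iff)
  have m: "m = a + b" and "n = m * \<mu> + a"
    unfolding assms(3,4)[symmetric] P by (simp_all add: algebra_simps)
  with balanced_eq[of a m \<mu>] show ?thesis
    unfolding P by simp
qed

lemma almost_equal_eq_balanced:
  assumes "1 \<le> m" and "m \<le> n"
  shows "almost_equal n m = balanced n m"
  unfolding almost_equal_def
proof (rule the_equality)
  let ?P = "balanced n m"
  have "Max_mset ?P \<in># ?P" "Min_mset ?P \<in># ?P"
    using balanced_nonempty[OF assms] by simp_all
  moreover have range: "n div m \<le> x \<and> x \<le> n div m + 1" if "x \<in># ?P" for x
    using that by (auto simp: balanced_def split: if_splits)
  ultimately have "Max_mset ?P - Min_mset ?P \<le> 1"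
    using range[of "Max_mset ?P"] range[of "Min_mset ?P"] by linarith
  moreover have "n mod m \<le> m"
    using assms by (simp add: less_imp_le)
  then have "size ?P = m"
    by (simp add: balanced_def)
  moreover have "sum_mset ?P = n"
  proof -
    have "sum_mset ?P = (n mod m + (m - n mod m)) * (n div m) + n mod m"
      by (simp add: balanced_def algebra_simps)
    with \<open>n mod m \<le> m\<close> show ?thesis by simp
  qed
  ultimately show "is_partition ?P \<and> sum_mset ?P = n \<and> size ?P = m \<and> Max_mset ?P - Min_mset ?P \<le> 1"
    using is_partition_balanced[OF assms] by simp
qed (use almost_equal_unique assms in auto)

text \<open>Here \<open>h\<close> separates the blocks: \<open>b \<le> h * n\<close> bounds all
  parts of the lower block by \<open>h\<close>, and \<open>(h + 1) * m < a\<close> puts the top part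
  of the upper block at \<open>h + 2\<close> or more. The chain then takes one part from each block,
  and they evolve independently.\<close>

lemma
  assumes "1 \<le> m" and "1 \<le> n" and "n \<le> b" and "b \<le> h * n" and "(h + 1) * m < a"
  shows burge_step_two_balanced: "burge_step (balanced a m + balanced b n) =
      balanced (a - 1) m + balanced (b - 1) (if b = n then n - 1 else n)"
    and burge_letter_two_balanced:
      "burge_letter (balanced a m + balanced b n) = (if b = n then \<beta> else \<alpha>)"
proof -
  have "h \<noteq> 0"
    using assms by (cases "h = 0") auto
  from assms(5) have "m < a" by simp
  then have am: "m \<le> a" "a \<noteq> m" by auto
  have "(h + 1) * m \<le> a - 1"
    using assms(5) by simp
  then have a: "h + 1 \<le> (a - 1) div m"
    using assms(1) by (simp add: less_eq_div_iff_mult_less_eq)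
  have low: "y \<le> h" if y: "y \<in># balanced b n" for y
  proof -
    have *: "y = b div n \<or> (y = b div n + 1 \<and> b mod n > 0)"
      using y by (auto simp: balanced_def split: if_splits)
    have "b div n \<le> h"
      using div_le_mono[OF assms(4), of n] assms(2) by simp
    moreover have "b div n < h" if "b mod n > 0"
    proof -
      have "n * (b div n) < b"
        using that by (metis div_mult_mod_eq less_add_same_cancel1 mult.commute)
      with assms(4) have "n * (b div n) < n * h"
        by (metis mult.commute less_le_trans)
      then show ?thesis by simp
    qed
    ultimately show ?thesis using * by auto
  qed
  have chain: "burge_chain (balanced a m + balanced b n) =
      burge_chain (balanced a m) @ burge_chain (balanced b n)"
    unfolding burge_chain_balanced[OF assms(1) am(1)] append_Cons append_Nil
    using low a
    by (intro burge_chain_union burge_chain_balanced assms(1) am(1)) fastforce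
  then show "burge_step (balanced a m + balanced b n) =
      balanced (a - 1) m + balanced (b - 1) (if b = n then n - 1 else n)"
    using am by (simp add: burge_step_union burge_step_balanced[OF assms(1) am(1)]
        burge_step_balanced[OF assms(2,3)])
  have "burge_letter (balanced a m) = \<alpha>"
    using am by (simp add: burge_letter_balanced[OF assms(1) am(1)])
  then have "burge_letter (balanced a m + balanced b n) = burge_letter (balanced b n)"
    by (auto simp: burge_letter_def chain split: if_splits)
  then show "burge_letter (balanced a m + balanced b n) = (if b = n then \<beta> else \<alpha>)"
    by (simp add: burge_letter_balanced[OF assms(2,3)])
qed

text \<open>The chain takes \<open>p + 3\<close>, skips \<open>p + 2\<close>, takes
  \<open>p + 1\<close> and skips \<open>p\<close>. This governs collisions; with
  \<open>p = 0\<close> it also covers partitions into parts 3, 2, 1, which lose a part.\<close>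

lemma
  fixes p :: nat
  defines "P a b c e \<equiv> replicate_mset a (p + 3) + replicate_mset b (p + 2)
    + replicate_mset c (p + 1) + replicate_mset e p"
  assumes "p = 0 \<Longrightarrow> e = 0"
  shows burge_step_four_values: "burge_step (P (Suc a) b (Suc c) e) =
      P a (Suc b) c (if p = 0 then 0 else Suc e)"
    and burge_letter_four_values:
      "burge_letter (P (Suc a) b (Suc c) e) = (if p = 0 then \<beta> else \<alpha>)"
proof -
  have "burge_chain (P (Suc a) b (Suc c) e) = (p + 3) #
      burge_chain {#j \<in># P (Suc a) b (Suc c) e. j + 2 \<le> p + 3#}"
    by (rule burge_chain_Cons) (auto simp: P_def split: if_splits)
  also have "{#j \<in># P (Suc a) b (Suc c) e. j + 2 \<le> p + 3#} =
      replicate_mset (Suc c) (p + 1) + replicate_mset e p"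
    by (auto simp: P_def multiset_eq_iff)
  also have "burge_chain \<dots> = [p + 1]"
    by (rule burge_chain_replicate) simp
  finally have chain: "burge_chain (P (Suc a) b (Suc c) e) = [p + 3, p + 1]" .
  show "burge_letter (P (Suc a) b (Suc c) e) = (if p = 0 then \<beta> else \<alpha>)"
    by (simp add: burge_letter_def chain)
  show "burge_step (P (Suc a) b (Suc c) e) = P a (Suc b) c (if p = 0 then 0 else Suc e)"
    using assms(2) unfolding burge_step_def chain by (auto simp: P_def multiset_eq_iff)
qed

section \<open>Separated and colliding clusters of parts\<close>

text \<open>The target word with \<open>s\<close> in place of \<open>u - r\<close>, so that
  \<open>s\<close> can vary while \<open>r\<close> and \<open>k\<close> stay fixed. A leading
  \<alpha> is removed by lowering \<open>s\<close>; on the diagonal \<open>s = l\<close> a leading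
  \<beta> is removed by lowering both.\<close>

definition two_block_word :: "nat \<Rightarrow> nat \<Rightarrow> nat \<Rightarrow> nat \<Rightarrow> letter list" where
  "two_block_word r k s l =
    replicate (s - l) \<alpha> @ replicate l \<beta> @ replicate (r - k) \<alpha> @ replicate k \<beta> @ [\<alpha>]"

lemma burge_code_two_block_beta:
  assumes "P \<noteq> {#}" and "burge_letter P = \<beta>"
    and "burge_code (burge_step P) = two_block_word r k l l"
  shows "burge_code P = two_block_word r k (Suc l) (Suc l)"
  using assms by (simp add: burge_code_Cons two_block_word_def)

lemma burge_code_two_block_alpha:
  assumes "P \<noteq> {#}" and "burge_letter P = \<alpha>" and "l \<le> s"
    and "burge_code (burge_step P) = two_block_word r k s l"
  shows "burge_code P = two_block_word r k (Suc s) l"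
  using assms by (simp add: burge_code_Cons two_block_word_def Suc_diff_le)

lemma burge_code_two_balanced_beta:
  assumes "1 \<le> m" and "1 \<le> n" and "2 * m < a"
    and "burge_code (balanced (a - 1) m + balanced (n - 1) (n - 1)) = two_block_word r k l l"
  shows "burge_code (balanced a m + balanced n n) = two_block_word r k (Suc l) (Suc l)"
  using assms burge_step_two_balanced[of m n n 1 a] burge_letter_two_balanced[of m n n 1 a]
    balanced_nonempty[of n n]
  by (intro burge_code_two_block_beta) simp_all

lemma burge_code_two_balanced_alpha:
  assumes "1 \<le> m" and "1 \<le> n" and "n < b" and "b \<le> h * n" and "(h + 1) * m < a" and "l \<le> s"
    and "burge_code (balanced (a - 1) m + balanced (b - 1) n) = two_block_word r k s l"
  shows "burge_code (balanced a m + balanced b n) = two_block_word r k (Suc s) l"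
  using assms burge_step_two_balanced[of m n b h a] burge_letter_two_balanced[of m n b h a]
    balanced_nonempty[of n b]
  by (intro burge_code_two_block_alpha) simp_all

section \<open>Codes of shapes outside a collision, and on the diagonal \<open>s = l\<close>\<close>

lemma obtain_ceiling:
  fixes b n :: nat
  assumes "1 \<le> n" and "1 \<le> b"
  obtains h where "b \<le> (h + 1) * n" and "h * n < b"
proof
  show "b \<le> ((b - 1) div n + 1) * n"
    using assms dividend_less_div_times[of n "b - 1"] by simp
  show "(b - 1) div n * n < b"
    using assms div_times_less_eq_dividend[of "b - 1" n] by linarith
qed

text \<open>For \<open>k \<le> l\<close> the lower block has the smaller average part, and
  \<open>2 * k \<le> r\<close> adds a gap of 2, so the blocks never interact. On the diagonal the
  lower block consists of ones, and steps stay on the diagonal.\<close>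

lemma burge_code_separated:
  assumes "1 \<le> k" and "2 * k \<le> r" and "l \<le> s" and "k \<le> l \<or> s = l"
  shows "burge_code (balanced (s + r) k + balanced s l) = two_block_word r k s l"
  using assms
proof (induction s arbitrary: l)
  case 0
  then show ?case
    using burge_code_balanced[of k r] by (simp add: two_block_word_def)
next
  case (Suc s)
  show ?case
  proof (cases "l = Suc s")
    case True
    with Suc.IH[of s] Suc.prems burge_code_two_balanced_beta[of k "Suc s" "Suc s + r" r k s]
    show ?thesis by simp
  next
    case False
    with Suc.prems have l: "1 \<le> l" "k \<le> l" "l < Suc s" by auto
    then obtain h where h: "Suc s \<le> (h + 1) * l" "h * l < Suc s"
      using obtain_ceiling[of l "Suc s"] by auto
    have "h * k \<le> h * l"
      using l by simp
    then have "h * k < Suc s"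
      using h(2) by linarith
    with Suc.prems(2) have "(h + 1 + 1) * k < Suc s + r"
      by (simp add: algebra_simps)
    with l h(1) Suc.prems(1) Suc.IH[of l] Suc.prems(2) show ?thesis
      by (intro burge_code_two_balanced_alpha[where h = "h + 1"]) auto
  qed
qed

text \<open>For \<open>r \<le> 2 * k\<close> the block $[r]^k$ consists of twos and ones. Read
  backwards, each \<beta> raises a 2 to 3 and adds a 1; \<open>k + l \<le> r\<close> ensures that
  enough twos are available.\<close>

lemma burge_code_three_values:
  assumes "1 \<le> k" and "r \<le> 2 * k" and "k + l \<le> r"
  shows "burge_code (replicate_mset l 3 + replicate_mset (r - k - l) 2 +
      replicate_mset (2 * k - r + l) 1) = two_block_word r k l l"
  using assms
proof (induction l)
  case 0
  have "balanced r k = balanced (k * 1 + (r - k)) k"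
    using 0 by simp
  also have "\<dots> = replicate_mset (r - k) 2 + replicate_mset (2 * k - r) 1"
    using 0 by (subst balanced_eq) (auto simp: mult_2 numeral_2_eq_2)
  finally show ?case
    using burge_code_balanced[of k r] 0 by (simp add: two_block_word_def)
next
  case (Suc l)
  have "r - k - l = Suc (r - k - Suc l)"
    using Suc.prems by simp
  with Suc show ?case
    using burge_step_four_values[of 0 0 l "r - k - Suc l" "2 * k - r + l"]
      burge_letter_four_values[of 0 0 l "r - k - Suc l" "2 * k - r + l"]
    by (intro burge_code_two_block_beta) (simp_all add: numeral_eq_Suc)
qed

lemma balanced_mult: "1 \<le> m \<Longrightarrow> balanced (m * p) m = replicate_mset m p"
  using balanced_eq[of 0 m p] by simp

text \<open>The shape of \<open>B\<close> at \<open>k = r - t\<close>, where no collision occurs for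
  any \<open>l \<ge> t\<close>. The induction effectively starts at \<open>s = l = t\<close>, with
  threes and ones only.\<close>

lemma burge_code_merged:
  assumes "1 \<le> t" and "2 * t < r" and "t \<le> l" and "l \<le> s"
  shows "burge_code (balanced (s + 2 * t) t + balanced (s + r - 2 * t) (l + r - 2 * t)) =
    two_block_word r (r - t) s l"
  using assms(3,4)
proof (induction s arbitrary: l)
  case 0
  then show ?case using assms(1) by simp
next
  case (Suc s)
  let ?x = "r - 2 * t"
  have x: "1 \<le> ?x" "\<And>n. n + r - 2 * t = n + ?x"
    using assms(2) by auto
  consider "l = Suc s" "l = t" | "l = Suc s" "t < l" | "l < Suc s"
    using Suc.prems by linarith
  then show ?case
  proof cases
    case 1
    have "Suc s + 2 * t = t * 3"
      using 1 by simp
    then have "balanced (Suc s + 2 * t) t = replicate_mset t 3"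
      using balanced_mult[of t 3] assms(1) by metis
    moreover have "l + r - 2 * t = r - t" "Suc s + r - 2 * t = r - t"
      using 1 assms(2) by auto
    moreover have "balanced (r - t) (r - t) = replicate_mset (r - t) 1"
      using balanced_mult[of "r - t" 1] assms(2) by simp
    moreover have "r - (r - t) - t = 0" "2 * (r - t) - r + t = r - t"
      using assms(2) by auto
    ultimately show ?thesis
      using burge_code_three_values[of "r - t" r t] assms(1,2) 1 by (simp del: One_nat_def)
  next
    case 2
    then show ?thesis
      unfolding 2(1) x(2) using Suc.IH[of s] assms(1)
        burge_code_two_balanced_beta[of t "Suc s + ?x" "Suc s + 2 * t" r "r - t" s]
      by (simp add: x(2))
  next
    case 3
    have "1 \<le> l + ?x" "1 \<le> Suc s + ?x"
      using x(1) by simp_all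
    then obtain h where h: "Suc s + ?x \<le> (h + 1) * (l + ?x)" "h * (l + ?x) < Suc s + ?x"
      by (rule obtain_ceiling)
    \<comment> \<open>Separation amounts to this bound. For \<open>h > 0\<close> it follows from
      \<open>h(2)\<close> by cancelling \<open>?x \<le> h * ?x\<close> and using
      \<open>t \<le> l\<close>.\<close>
    have "h * t < Suc s"
    proof (cases "h = 0")
      case False
      then have "?x \<le> h * ?x" "h * t \<le> h * l"
        using Suc.prems by simp_all
      moreover have "h * l + h * ?x < Suc s + ?x"
        using h(2) by (simp only: add_mult_distrib2)
      ultimately show ?thesis by linarith
    qed simp
    then have "(h + 1 + 1) * t < Suc s + 2 * t"
      by (simp add: algebra_simps)
    moreover have "burge_code (balanced (s + 2 * t) t + balanced (s + ?x) (l + ?x)) =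
        two_block_word r (r - t) s l"
      using Suc.IH[of l] 3 Suc.prems(1) by (simp only: x(2) less_Suc_eq_le)
    then have "burge_code (balanced (Suc s + 2 * t - 1) t + balanced (Suc s + ?x - 1) (l + ?x)) =
        two_block_word r (r - t) s l"
      by simp
    moreover have "1 \<le> l + ?x" "l + ?x < Suc s + ?x" "l \<le> s"
      using 3 x(1) by simp_all
    ultimately show ?thesis
      unfolding x(2) using assms(1) h(1)
      by (intro burge_code_two_balanced_alpha[where h = "h + 1"])
  qed
qed

text \<open>With \<open>s = t * q - d\<close> and \<open>x = r - 2 * t - q * (k - t)\<close>, the partition in transit
  between the two separated shapes: \<open>q\<close> is the largest part of $[s]^t$, and \<open>x\<close> does not
  change while \<open>d\<close> runs from \<open>0\<close> to \<open>t\<close>.\<close>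

definition colliding :: "nat \<Rightarrow> nat \<Rightarrow> nat \<Rightarrow> nat \<Rightarrow> nat \<Rightarrow> nat multiset" where
  "colliding t k x q d = replicate_mset (t - d) (q + 2) + replicate_mset (d + x) (q + 1)
    + replicate_mset (k - d - x) q + replicate_mset d (q - 1)"

text \<open>The start of the collision is the shape of \<open>B\<close>;
  \<open>colliding_full\<close> identifies its end with the shape of \<open>A\<close>.\<close>

lemma colliding_0:
  assumes "1 \<le> t" and "x \<le> k"
  shows "colliding t k x q 0 = balanced (t * (q + 2)) t + balanced (k * q + x) k"
  using assms by (simp only: balanced_mult balanced_eq) (simp add: colliding_def)

lemma colliding_full:
  assumes "1 \<le> t" and "t + x \<le> k" and "1 \<le> q"
  shows "colliding t k x q t = balanced (k * q + (t + x)) k + balanced (t * (q - 1)) t"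
  using assms by (simp only: balanced_mult balanced_eq) (simp add: colliding_def)

text \<open>Each step trades a part \<open>q + 2\<close> for \<open>q + 1\<close> and a part
  \<open>q\<close> for \<open>q - 1\<close>. As \<open>q \<ge> 2\<close>, no part vanishes.\<close>

lemma
  assumes "d < t" and "d + x < k" and "2 \<le> q"
  shows burge_step_colliding: "burge_step (colliding t k x q d) = colliding t k x q (Suc d)"
    and burge_letter_colliding: "burge_letter (colliding t k x q d) = \<alpha>"
    and colliding_nonempty: "colliding t k x q d \<noteq> {#}"
proof -
  have eq: "t - d = Suc (t - Suc d)" "k - d - x = Suc (k - Suc d - x)" "q = (q - 1) + 1"
    using assms by auto
  have *: "colliding t k x q d = replicate_mset (Suc (t - Suc d)) (q - 1 + 3)
      + replicate_mset (d + x) (q - 1 + 2) + replicate_mset (Suc (k - Suc d - x)) (q - 1 + 1)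
      + replicate_mset d (q - 1)"
    unfolding colliding_def eq(1,2) using assms(3) by simp
  have **: "colliding t k x q (Suc d) = replicate_mset (t - Suc d) (q - 1 + 3)
      + replicate_mset (Suc (d + x)) (q - 1 + 2) + replicate_mset (k - Suc d - x) (q - 1 + 1)
      + replicate_mset (Suc d) (q - 1)"
    unfolding colliding_def using assms(3) by simp
  have "q - 1 \<noteq> 0"
    using assms by simp
  then show "burge_step (colliding t k x q d) = colliding t k x q (Suc d)"
    and "burge_letter (colliding t k x q d) = \<alpha>"
    unfolding * ** by (subst burge_step_four_values burge_letter_four_values; simp)+
  show "colliding t k x q d \<noteq> {#}"
    unfolding * by simp
qed

text \<open>The core of the proof, for \<open>l = t\<close>, \<open>k = t + j\<close>,
  \<open>r = 2 * t + y\<close>. The hypotheses make \<open>q\<close> the ceiling of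
  \<open>s / t\<close>, and the position of \<open>y\<close> relative to \<open>q * j\<close> and
  \<open>(q + 1) * j\<close> selects the shape. The three claims need one common induction, since
  lowering \<open>s\<close> leads from \<open>B\<close> through the collision to \<open>A\<close>.
  The ranges overlap at their ends, where both descriptions hold.\<close>

lemma burge_code_phases:
  fixes t j y :: nat
  defines "W \<equiv> \<lambda>s. two_block_word (2 * t + y) (t + j) s t"
  assumes "1 \<le> t" and "1 \<le> j" and "j \<le> y" and "t \<le> s" and "s + d = t * q" and "d < t"
  shows "((q + 1) * j \<le> y \<longrightarrow>
        burge_code (balanced (s + (2 * t + y)) (t + j) + balanced s t) = W s) \<and>
      (y \<le> q * j \<longrightarrow>
        burge_code (balanced (s + 2 * t) t + balanced (s + y) (t + j)) = W s) \<and>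
      (q * j \<le> y \<and> y \<le> (q + 1) * j \<longrightarrow>
        burge_code (colliding t (t + j) (y - q * j) q d) = W s)"
  using assms(5-)
proof (induction s arbitrary: q d)
  case 0
  then show ?case using assms(2) by simp
next
  case (Suc s)
  show ?case
  proof (cases "Suc s = t")
    \<comment> \<open>The start \<open>s = l = t\<close> forces \<open>q = 1\<close> and
      \<open>d = 0\<close>: the shape of \<open>A\<close> is separated, and the other two have parts
      at most 3.\<close>
    case True
    have "t * q < t * 2" "0 < t * q"
      using Suc.prems True assms(2) by linarith+
    then have q: "q = 1"
      using mult_le_mono2[of 2 q t] by (cases "2 \<le> q") auto
    then have d: "d = 0"
      using Suc.prems True by simp
    have "burge_code (balanced (t + (2 * t + y)) (t + j) + balanced t t) = W t" if "2 * j \<le> y"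
      using burge_code_separated[of "t + j" "2 * t + y" t t] that assms(2) by (simp add: W_def)
    moreover have "burge_code (balanced (t + 2 * t) t + balanced (t + y) (t + j)) = W t" if "y \<le> j"
      using burge_code_three_values[of "t + j" "2 * t + j" t] that assms(2-4)
        balanced_mult[of t 3] balanced_mult[of "t + j" 1] by (simp add: W_def mult_2 numeral_3_eq_3 add.commute)
    moreover have "burge_code (colliding t (t + j) (y - j) 1 0) = W t" if "y \<le> 2 * j"
    proof -
      have "2 * (t + j) - (2 * t + y) + t = t + j - (y - j)"
        using that assms(4) by simp
      then show ?thesis
        using burge_code_three_values[of "t + j" "2 * t + y" t] that assms(2-4)
        by (simp add: W_def colliding_def numeral_eq_Suc)
    qed
    ultimately show ?thesis
      by (simp add: True q d)
  next
    case False
    with Suc.prems have s: "t \<le> s" by simp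
    have "t * 1 < t * q"
      using Suc.prems False by linarith
    then have "1 < q"
      by simp
    then obtain p where p: "q = Suc p" "1 \<le> p"
      by (cases q) auto
    have qt: "Suc s + d = q * t"
      using Suc.prems by (simp add: mult.commute)
    \<comment> \<open>Either the period of \<open>t\<close> steps continues with the same
      \<open>q\<close>, or it ends, and \<open>q\<close> drops to \<open>p\<close> while
      \<open>d\<close> returns to 0.\<close>
    consider (same) "Suc d < t" | (nxt) "Suc d = t"
      using Suc.prems by linarith
    note phase = this
    have next_eq: "s = t * p" if "Suc d = t"
      using Suc.prems(2) that by (simp add: p)
    have "burge_code (balanced (Suc s + (2 * t + y)) (t + j) + balanced (Suc s) t) = W (Suc s)"
      if "(q + 1) * j \<le> y"
    proof -
      have "burge_code (balanced (s + (2 * t + y)) (t + j) + balanced s t) = W s"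
        using phase
      proof cases
        case same
        with Suc.IH[of "Suc d" q] Suc.prems s that show ?thesis by simp
      next
        case nxt
        moreover from that have "(p + 1) * j \<le> y" by (simp add: p)
        ultimately show ?thesis
          using Suc.IH[of 0 p] s next_eq assms(2) by simp
      qed
      \<comment> \<open>Parts of the lower block are at most \<open>q\<close>; the bound on
        \<open>y\<close> and the slack \<open>d < t\<close> lift the top of the other block to at
        least \<open>q + 2\<close>.\<close>
      moreover have "(q + 1) * (t + j) < Suc s + (2 * t + y)"
        using that qt Suc.prems(3) by (simp add: algebra_simps)
      moreover have "Suc s \<le> q * t"
        using qt by linarith
      ultimately show ?thesis
        using s assms(2) unfolding W_def
        by (intro burge_code_two_balanced_alpha[where h = q]) simp_all
    qed
    moreover have "burge_code (balanced (Suc s + 2 * t) t + balanced (Suc s + y) (t + j)) = W (Suc s)"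
      if "y \<le> q * j"
    proof -
      have "burge_code (balanced (s + 2 * t) t + balanced (s + y) (t + j)) = W s"
        using phase
      proof cases
        case same
        with Suc.IH[of "Suc d" q] Suc.prems s that show ?thesis by simp
      next
        case nxt
        show ?thesis
        proof (cases "y \<le> p * j")
          case True
          then show ?thesis
            using Suc.IH[of 0 p] s next_eq[OF nxt] assms(2) by simp
        next
          case False
          \<comment> \<open>The collision begins exactly here: the shape of \<open>B\<close> at the
            start of the new period is the colliding one with \<open>d = 0\<close>.\<close>
          with that have y: "p * j \<le> y" "y \<le> (p + 1) * j" by (simp_all add: p)
          then have shape: "t * (p + 2) = s + 2 * t" "(t + j) * p + (y - p * j) = s + y"
            using next_eq[OF nxt] by (simp_all add: algebra_simps)
          have "y - p * j \<le> t + j"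
            using y by simp
          from colliding_0[OF assms(2) this, of p]
          have "colliding t (t + j) (y - p * j) p 0 =
              balanced (s + 2 * t) t + balanced (s + y) (t + j)"
            by (simp only: shape)
          moreover have "burge_code (colliding t (t + j) (y - p * j) p 0) = W s"
            using Suc.IH[of 0 p] s next_eq[OF nxt] assms(2) y by simp
          ultimately show ?thesis by simp
        qed
      qed
      moreover have "(q + 1) * t < Suc s + 2 * t"
        using qt Suc.prems(3) by (simp add: algebra_simps)
      moreover have "Suc s + y \<le> q * (t + j)"
        using qt that by (simp add: algebra_simps)
      ultimately show ?thesis
        using s assms(2-4) unfolding W_def
        by (intro burge_code_two_balanced_alpha[where h = q]) simp_all
    qed
    moreover have "burge_code (colliding t (t + j) (y - q * j) q d) = W (Suc s)"
      if y: "q * j \<le> y" "y \<le> (q + 1) * j"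
    proof -
      let ?x = "y - q * j"
      have x: "?x \<le> j"
        using y by simp
      have "burge_code (colliding t (t + j) ?x q (Suc d)) = W s"
        using phase
      proof cases
        case same
        with Suc.IH[of "Suc d" q] Suc.prems s y show ?thesis by simp
      next
        case nxt
        \<comment> \<open>After the full period the colliding partition is the shape of
          \<open>A\<close>, and \<open>q * j \<le> y\<close> is the condition for \<open>A\<close>
          in the next period because \<open>q = p + 1\<close>.\<close>
        have shape: "(t + j) * q + (t + ?x) = s + (2 * t + y)"
        proof -
          have "(t + j) * q + (t + ?x) = q * t + t + (q * j + ?x)"
            by (simp add: algebra_simps del: diff_mult_distrib diff_mult_distrib2)
          also have "q * j + ?x = y"
            using y(1) by simp
          finally show ?thesis
            unfolding qt[symmetric] using nxt by simp
        qed
        have "t + ?x \<le> t + j" "1 \<le> q"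
          using x p by auto
        from colliding_full[OF assms(2) this]
        have "colliding t (t + j) ?x q (Suc d) = balanced (s + (2 * t + y)) (t + j) + balanced s t"
          unfolding shape nxt by (simp add: p next_eq[OF nxt])
        moreover have "(p + 1) * j \<le> y"
          using y by (simp add: p)
        ultimately show ?thesis
          using Suc.IH[of 0 p] s next_eq[OF nxt] assms(2) by simp
      qed
      moreover have "d + ?x < t + j" "2 \<le> q"
        using x Suc.prems(3) p by auto
      ultimately show ?thesis
        using Suc.prems(3) s unfolding W_def
        by (intro burge_code_two_block_alpha) (simp_all add: burge_step_colliding burge_letter_colliding colliding_nonempty)
    qed
    ultimately show ?thesis by blast
  qed
qed

section \<open>The entries of the table\<close>

lemma nat_ceiling_divide_le_iff:
  "0 < b \<Longrightarrow> nat \<lceil>real a / real b\<rceil> \<le> m \<longleftrightarrow> a \<le> m * b"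
  by (simp add: nat_le_iff ceiling_le_iff divide_le_eq flip: of_nat_mult)

lemma q_t_le_iff: "1 \<le> t \<Longrightarrow> q_t u r t \<le> m \<longleftrightarrow> u - r \<le> m * t"
  unfolding q_t_def by (intro nat_ceiling_divide_le_iff) simp

lemma d_t_less:
  assumes "1 \<le> t"
  shows "d_t u r t < t"
proof (cases "q_t u r t")
  case 0
  with assms show ?thesis by (simp add: d_t_def)
next
  case (Suc q)
  then have "\<not> q_t u r t \<le> q" by simp
  with assms have "t * q < u - r"
    by (simp add: q_t_le_iff mult.commute)
  with Suc assms show ?thesis by (simp add: d_t_def)
qed

lemma q_t_d_t: "1 \<le> t \<Longrightarrow> u - r + d_t u r t = t * q_t u r t"
  using q_t_le_iff[of t u r "q_t u r t"] by (simp add: d_t_def mult.commute)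

text \<open>With \<open>c_t_le_iff\<close>, this turns the limits of the table sets into the
  comparisons of \<open>y = r - 2 * t\<close> with \<open>(q + 1) * j\<close> and
  \<open>q * j\<close> that separate the phases.\<close>

lemma k_t_le_iff:
  "1 \<le> t \<Longrightarrow> k_t u r t \<le> t + j \<longleftrightarrow> r - 2 * t < (q_t u r t + 1) * j"
  by (simp add: k_t_def Suc_le_eq div_less_iff_less_mult mult.commute)

lemma c_t_le_iff:
  assumes "1 \<le> t" and "0 < d_t u r t" and "0 < q_t u r t"
  shows "c_t u r t \<le> t + j \<longleftrightarrow> r - 2 * t \<le> q_t u r t * j"
  using assms nat_ceiling_divide_le_iff[of "q_t u r t" "r - 2 * t" j]
  by (simp add: c_t_def mult.commute)

lemma k_t_ge: "t \<le> k_t u r t"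
  by (simp add: k_t_def)

lemma q_t_pos: "1 \<le> t \<Longrightarrow> r < u \<Longrightarrow> 0 < q_t u r t"
  using q_t_le_iff[of t u r 0] by auto

text \<open>For \<open>k \<le> l\<close> the blocks are separated. For \<open>l < k\<close> the
  phases apply with \<open>l\<close> in the role of \<open>t\<close>, so the condition for
  \<open>A\<close> must be carried over from \<open>t\<close> to \<open>l\<close>.\<close>

lemma burge_code_below_k_t:
  assumes "r < u" and "1 \<le> t" and "t \<le> l" and "l \<le> u - r" and "2 * t < r"
    and "1 \<le> k" and "k < k_t u r t"
  shows "burge_code (balanced u k + balanced (u - r) l) = two_block_word r k (u - r) l"
proof -
  have u: "u - r + r = u"
    using assms(1) by simp
  show ?thesis
  proof (cases "k \<le> t")
    case True
    then show ?thesis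
      using burge_code_separated[of k r l "u - r"] assms by (simp add: u)
  next
    case False
    then obtain i where i: "k = t + i" "1 \<le> i"
      by (metis less_iff_Suc_add not_le add_Suc_right Suc_eq_plus1 le_add2)
    have large: "(q_t u r t + 1) * i \<le> r - 2 * t"
      using assms(7) k_t_le_iff[OF assms(2), of u r i] i by simp
    have "2 * i \<le> (q_t u r t + 1) * i"
      using q_t_pos[OF assms(2,1)] by (intro mult_le_mono1) simp
    with large have two_i: "2 * i \<le> r - 2 * t"
      by linarith
    show ?thesis
    proof (cases "k \<le> l")
      case True
      then show ?thesis
        using burge_code_separated[of k r l "u - r"] assms i two_i by (simp add: u)
    next
      case False
      define j y where "j = k - l" and "y = r - 2 * l"
      have l: "1 \<le> l"
        using assms(2,3) by simp
      have q: "q_t u r l \<le> q_t u r t"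
      proof -
        have "u - r \<le> q_t u r t * t"
          using q_t_le_iff[OF assms(2), of u r "q_t u r t"] by simp
        also have "\<dots> \<le> q_t u r t * l"
          using assms(3) by simp
        finally show ?thesis
          by (simp add: q_t_le_iff[OF l])
      qed
      have "l < t + i"
        using False i by simp
      then have ry: "k = l + j" "r = 2 * l + y" "1 \<le> j"
        using two_i assms(5) i by (auto simp: j_def y_def)
      have "i = j + (l - t)"
        using i ry assms(3) by simp
      have "(q_t u r l + 1) * j \<le> (q_t u r t + 1) * j"
        using q by (intro mult_le_mono1) simp
      \<comment> \<open>Passing from \<open>t\<close> to \<open>l\<close> lowers \<open>i\<close> to
        \<open>j\<close> by \<open>l - t\<close>. Each unit lowers the left side of
        \<open>large\<close> by at least 2, while \<open>r - 2 * t\<close> falls by exactly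
        2.\<close>
      moreover have "(q_t u r t + 1) * j + 2 * (l - t) \<le> (q_t u r t + 1) * i"
      proof -
        have "2 * (l - t) \<le> (q_t u r t + 1) * (l - t)"
          using q_t_pos[OF assms(2,1)] by (intro mult_le_mono1) simp
        then show ?thesis
          unfolding \<open>i = _\<close> add_mult_distrib2 by simp
      qed
      moreover have "r - 2 * t = y + 2 * (l - t)"
        using ry assms(3) by simp
      ultimately have "(q_t u r l + 1) * j \<le> y"
        using large by linarith
      moreover from this have "j \<le> y"
        by simp
      ultimately show ?thesis
        using burge_code_phases[OF l ry(3) _ assms(4) q_t_d_t[OF l] d_t_less[OF l], of y, folded ry(1,2)]
        by (simp only: u)
    qed
  qed
qed

section \<open>Codes of the three kinds of table entries\<close>

lemma is_partition_plus: "is_partition P \<Longrightarrow> is_partition R \<Longrightarrow> is_partition (P + R)"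
  by (simp add: is_partition_def)

lemma table_entry_A:
  assumes "2 \<le> r" and "r < u" and "1 \<le> k" and "k \<le> r - 1" and "1 \<le> l" and "l \<le> u - r"
    and "1 \<le> t" and "t \<le> t_max u r + 1" and "(k, l) \<in> A_set u r t"
  shows "burge_code (balanced u k + balanced (u - r) l) = two_block_word r k (u - r) l"
proof (cases "t = t_max u r + 1")
  case True
  with assms(9) have *: "k = r - t" "t \<le> l"
    by (auto simp: A_set_def)
  \<comment> \<open>A member of the last set has \<open>t_max u r < l \<le> u - r\<close>, so the
    minimum defining \<open>t_max\<close> is attained by its second argument.\<close>
  with True assms(6) have "t = (r - 1) div 2 + 1"
    by (auto simp: t_max_def min_def split: if_splits)
  then have "r \<le> 2 * t" by linarith
  with * have "2 * k \<le> r" "k \<le> l" by linarith+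
  then show ?thesis
    using burge_code_separated[of k r l "u - r"] assms by simp
next
  case False
  with assms(8) have "t \<le> t_max u r" by simp
  then have "2 * t < r"
    using assms(1) by (auto simp: t_max_def)
  with False assms show ?thesis
    by (intro burge_code_below_k_t[of _ _ t]) (auto simp: A_set_def)
qed

lemma table_entry_B:
  assumes "2 \<le> r" and "r < u" and "1 \<le> k" and "k \<le> r - 1" and "1 \<le> l" and "l \<le> u - r"
    and "1 \<le> t" and "t \<le> t_max u r" and "(k, l) \<in> B_set u r t"
  shows "burge_code (balanced (u - r + 2 * t) t + balanced (u - 2 * t) (k + l - t)) =
    two_block_word r k (u - r) l"
proof -
  have t: "2 * t < r" "t \<le> u - r"
    using assms(1,8) by (auto simp: t_max_def)
  have u: "u - r + r = u"
    using assms(2) by simp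
  show ?thesis
  proof (cases "k = r - t")
    case True
    then have "t \<le> l" "k + l - t = l + r - 2 * t"
      using assms(9) t by (auto simp: B_set_def)
    then show ?thesis
      using burge_code_merged[of t r l "u - r"] assms(6,7) t True by (simp add: u)
  next
    case False
    define y q d where "y = r - 2 * t" and "q = q_t u r t" and "d = d_t u r t"
    have l: "l = t" "c_t u r t \<le> k" "k < r - t"
      using False assms(9) by (auto simp: B_set_def)
    have "t \<le> c_t u r t"
      by (simp add: c_t_def k_t_ge)
    define j where "j = k - t"
    have kj: "k = t + j" and ry: "r = 2 * t + y"
      using l \<open>t \<le> c_t u r t\<close> t by (auto simp: j_def y_def)
    have "j \<le> y" "1 \<le> y"
      using l(3) t by (auto simp: kj ry)
    have uy: "u - 2 * t = u - r + y"
      using assms(2) ry by simp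
    \<comment> \<open>For \<open>d = 0\<close> the row of \<open>B\<close> starts at
      \<open>k_t\<close>, hence includes the middle phase; there the colliding partition is still
      the shape of \<open>B\<close>.\<close>
    have goal: ?thesis if "1 \<le> j" "y \<le> q * j \<or> (d = 0 \<and> q * j \<le> y \<and> y \<le> (q + 1) * j)"
    proof -
      note phases = burge_code_phases[of t j y "u - r" d q]
      have "u - r + d = t * q" "d < t"
        using assms(7) by (simp_all add: q_def d_def q_t_d_t d_t_less)
      note phases = phases[OF assms(7) that(1) \<open>j \<le> y\<close> t(2) this, folded kj ry]
      from that(2) show ?thesis
      proof
        assume "y \<le> q * j"
        with phases show ?thesis
          by (simp add: l(1) uy kj)
      next
        assume *: "d = 0 \<and> q * j \<le> y \<and> y \<le> (q + 1) * j"
        then have "y \<le> q * j + j" by simp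
        then have "y - q * j \<le> k"
          unfolding kj by linarith
        moreover have "t * (q + 2) = u - r + 2 * t" "k * q + (y - q * j) = u - r + y"
          using * \<open>u - r + d = t * q\<close> by (simp_all add: kj algebra_simps)
        ultimately have "colliding t k (y - q * j) q d =
            balanced (u - r + 2 * t) t + balanced (u - r + y) k"
          using colliding_0[OF assms(7), of "y - q * j" k q] * by (simp only:)
        with phases * show ?thesis
          by (simp add: l(1) uy kj)
      qed
    qed
    have "0 < q"
      unfolding q_def using assms(7,2) by (rule q_t_pos)
    show ?thesis
    proof (cases "d = 0")
      case True
      then have "y < (q + 1) * j"
        using l(2) k_t_le_iff[OF assms(7), of u r j] by (simp add: c_t_def d_def q_def y_def kj)
      then show ?thesis
        using True \<open>1 \<le> y\<close> by (intro goal) (cases j; auto)+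
    next
      case False
      then have "y \<le> q * j"
        using l(2) c_t_le_iff[OF assms(7), of u r j] \<open>0 < q\<close> by (simp add: d_def q_def y_def kj)
      then show ?thesis
        using \<open>1 \<le> y\<close> by (intro goal) (cases j; auto)+
    qed
  qed
qed

lemma table_entry_C:
  assumes "2 \<le> r" and "r < u"
    and "1 \<le> t" and "t \<le> t_max u r" and "(k, l) \<in> C_set u r t"
  defines "q \<equiv> q_t u r t" and "d \<equiv> d_t u r t"
  shows "burge_code (balanced (u - r + 2 * t) t + balanced (u - 2 * t - d * (q - 1)) (k - d)
      + replicate_mset d (q - 1)) = two_block_word r k (u - r) l"
    and "d < k" and "k - d \<le> u - 2 * t - d * (q - 1)" and "0 < d \<Longrightarrow> 1 < q"
proof -
  have t: "2 * t < r" "t \<le> u - r"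
    using assms(1,4) by (auto simp: t_max_def)
  have l: "l = t" "k_t u r t \<le> k" "k < c_t u r t"
    using assms(5) by (auto simp: C_set_def)
  \<comment> \<open>For \<open>d = 0\<close> the limits \<open>c_t\<close> and \<open>k_t\<close>
    coincide and leave no room for \<open>C\<close>.\<close>
  then have "0 < d"
    by (auto simp: c_t_def d_def split: if_splits)
  have "0 < q"
    unfolding q_def using assms(3,2) by (rule q_t_pos)
  have qd: "u - r + d = t * q" "d < t"
    using assms(3) by (simp_all add: q_def d_def q_t_d_t d_t_less)
  define y j where "y = r - 2 * t" and "j = k - t"
  have kj: "k = t + j" and ry: "r = 2 * t + y"
    using l(2) k_t_ge[of t u r] t by (auto simp: j_def y_def)
  have y: "y < (q + 1) * j" "q * j < y"
    using l k_t_le_iff[OF assms(3), of u r j] c_t_le_iff[OF assms(3), of u r j] \<open>0 < d\<close> \<open>0 < q\<close>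
    by (simp_all add: d_def q_def y_def kj not_le)
  then have "1 \<le> j"
    by (cases j) auto
  have "j \<le> q * j"
    using \<open>0 < q\<close> by simp
  with y have "j \<le> y" by linarith
  show "d < k"
    using qd(2) kj by simp
  show "1 < q" if "0 < d"
  proof (rule ccontr)
    assume "\<not> 1 < q"
    with \<open>0 < q\<close> have "q = 1" by simp
    with qd t(2) \<open>0 < d\<close> show False by simp
  qed
  obtain p where p: "q = Suc p"
    using \<open>0 < q\<close> by (cases q) auto
  define x where "x = y - q * j"
  have x: "y = q * j + x" "x < j"
    using y by (auto simp: x_def)
  define e where "e = k - d"
  have e: "k = d + e"
    using \<open>d < k\<close> by (simp add: e_def)
  have "u - 2 * t = u - r + y"
    using assms(2) ry by simp
  moreover have "u - r + y + d = d * (q - 1) + d + e * q + x"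
  proof -
    have "u - r + y + d = (u - r + d) + y"
      by simp
    also have "\<dots> = t * q + (q * j + x)"
      by (simp only: qd(1) x(1)[symmetric])
    also have "\<dots> = (t + j) * q + x"
      by (simp add: algebra_simps)
    also have "t + j = d + e"
      using e kj by simp
    finally show ?thesis
      by (simp add: p algebra_simps)
  qed
  ultimately have rest: "u - 2 * t - d * (q - 1) = e * q + x"
    by linarith
  show "k - d \<le> u - 2 * t - d * (q - 1)"
    unfolding rest using \<open>0 < q\<close> by (simp add: e_def[symmetric] trans_le_add1)
  have "t * (q + 1) = t * q + t"
    by simp
  with qd have shape: "u - r + 2 * t = t * (q + 1) + (t - d)"
    by linarith
  \<comment> \<open>The first block supplies \<open>d\<close> parts \<open>q + 1\<close> and the
    second \<open>x\<close> more; together they form the \<open>d + x\<close> equal parts of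
    \<open>colliding\<close>.\<close>
  have "balanced (t * (q + 1) + (t - d)) t = replicate_mset (t - d) (q + 2) + replicate_mset d (q + 1)"
    using balanced_eq[of "t - d" t "q + 1"] qd(2) by simp
  moreover have "balanced (e * q + x) e = replicate_mset x (q + 1) + replicate_mset (e - x) q"
    using x(2) qd(2) kj e by (intro balanced_eq) linarith
  ultimately have "balanced (u - r + 2 * t) t + balanced (u - 2 * t - d * (q - 1)) (k - d)
      + replicate_mset d (q - 1) = colliding t k x q d"
    unfolding rest shape e_def[symmetric] colliding_def by (simp add: multiset_eq_iff)
  then show "burge_code (balanced (u - r + 2 * t) t + balanced (u - 2 * t - d * (q - 1)) (k - d)
      + replicate_mset d (q - 1)) = two_block_word r k (u - r) l"
    using burge_code_phases[OF assms(3) \<open>1 \<le> j\<close> \<open>j \<le> y\<close> t(2) qd, folded kj ry x_def,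
        THEN conjunct2, THEN conjunct2] less_imp_le[OF y(1)] less_imp_le[OF y(2)] l(1)
    by (simp only: simp_thms)
qed

lemma is_table_entry_burge_code:
  assumes "2 \<le> r" and "r < u" and "1 \<le> k" and "k \<le> r - 1" and "1 \<le> l" and "l \<le> u - r"
    and "is_table_entry u r k l P"
  shows "is_partition P \<and> burge_code P = two_block_word r k (u - r) l"
  using assms(7)
proof cases
  case (A t)
  have "k \<le> u"
    using assms by simp
  with assms(3,5,6) have "P = balanced u k + balanced (u - r) l"
    by (simp add: A(1) almost_equal_eq_balanced)
  with table_entry_A[OF assms(1-6) A(2-)] \<open>k \<le> u\<close> assms(3,5,6) show ?thesis
    by (simp add: is_partition_plus is_partition_balanced)
next
  case (B t)
  then have t: "2 * t < r" "t \<le> u - r"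
    using assms(1) by (auto simp: t_max_def)
  have "k + l - t = l + (k - t) \<and> t \<le> k \<and> t \<le> l \<and> k \<le> r - t"
    using B(4) t k_t_ge[of t u r] by (auto simp: B_set_def c_t_def split: if_splits)
  with t assms have *: "1 \<le> k + l - t" "k + l - t \<le> u - 2 * t"
    by auto
  with B(2) have "P = balanced (u - r + 2 * t) t + balanced (u - 2 * t) (k + l - t)"
    using t(2) by (simp add: B(1) almost_equal_eq_balanced)
  with table_entry_B[OF assms(1-6) B(2-)] * B(2) t(2) show ?thesis
    by (simp add: is_partition_plus is_partition_balanced)
next
  case (C t)
  then have t: "2 * t < r" "t \<le> u - r"
    using assms(1) by (auto simp: t_max_def)
  note entry = table_entry_C[OF assms(1,2) C(2-)]
  from entry(2,3) C(2) t(2) have "P = balanced (u - r + 2 * t) t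
      + balanced (u - 2 * t - d_t u r t * (q_t u r t - 1)) (k - d_t u r t)
      + replicate_mset (d_t u r t) (q_t u r t - 1)"
    by (simp add: C(1) almost_equal_eq_balanced)
  moreover have "is_partition (replicate_mset (d_t u r t) (q_t u r t - 1))"
    using entry(4) by (auto simp: is_partition_def)
  ultimately show ?thesis
    using entry(1-3) C(2) t(2) by (simp add: is_partition_plus is_partition_balanced)
qed

text \<open>Only covering is shown. Overlaps are harmless, since all entries for
  \<open>(k, l)\<close> have the same code. The least \<open>t\<close> with
  \<open>k < k_t u r t\<close> gives a set \<open>A\<close>; its lower limit is the minimality of
  \<open>t\<close>, or \<open>k_0 = 1\<close>.\<close>

lemma is_table_entry_exists:
  assumes "2 \<le> r" and "r < u" and "1 \<le> k" and "k \<le> r - 1" and "1 \<le> l" and "l \<le> u - r"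
  shows "\<exists>P. is_table_entry u r k l P"
proof (cases "\<exists>t. 1 \<le> t \<and> t \<le> min l (t_max u r) \<and> k < k_t u r t")
  case True
  define first where "first t \<longleftrightarrow> 1 \<le> t \<and> t \<le> min l (t_max u r) \<and> k < k_t u r t" for t
  define t where "t = (LEAST t. first t)"
  have t: "1 \<le> t" "t \<le> min l (t_max u r)" "k < k_t u r t"
  proof -
    have "first t"
      unfolding t_def by (rule LeastI_ex) (use True in \<open>simp add: first_def\<close>)
    then show "1 \<le> t" "t \<le> min l (t_max u r)" "k < k_t u r t"
      by (simp_all add: first_def)
  qed
  have "k_t u r (t - 1) \<le> k"
  proof (cases "t = 1")
    case True
    with assms(3) show ?thesis by (simp add: k_t_def)
  next
    case False
    have "\<not> first (t - 1)"
      using t(1) by (intro not_less_Least) (simp flip: t_def)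
    with t(1,2) False show ?thesis by (auto simp: first_def)
  qed
  with t assms(6) have "(k, l) \<in> A_set u r t"
    by (auto simp: A_set_def)
  with t show ?thesis
    using is_table_entry.A[of t u r k l] by auto
next
  case False
  let ?m = "t_max u r"
  have ge: "k_t u r t \<le> k" if "1 \<le> t" "t \<le> l" "t \<le> ?m" for t
    using False that by (meson min.boundedI not_less)
  \<comment> \<open>The smallest of \<open>l\<close>, \<open>r - k\<close> and \<open>t_max\<close>
    decides: row \<open>l\<close> of \<open>C\<close> or \<open>B\<close>, the column of
    \<open>B\<close> at \<open>t = r - k\<close>, or the last set \<open>A\<close>.\<close>
  consider "l \<le> ?m" "l \<le> r - k" | "r - k < l" "r - k \<le> ?m" | "?m < l" "?m < r - k"
    by linarith
  then show ?thesis
  proof cases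
    case 1
    then have "(k, l) \<in> C_set u r l \<or> (k, l) \<in> B_set u r l"
      using ge[of l] assms by (auto simp: C_set_def B_set_def)
    with 1(1) assms(5) show ?thesis
      by (blast intro: is_table_entry.B is_table_entry.C)
  next
    case 2
    have "1 \<le> r - k"
      using assms by simp
    moreover have "(k, l) \<in> B_set u r (r - k)"
      using 2 assms by (auto simp: B_set_def)
    ultimately show ?thesis
      using 2(2) by (blast intro: is_table_entry.B)
  next
    case 3
    have m: "?m = (r - 1) div 2"
      using 3(1) assms(6) by (auto simp: t_max_def min_def split: if_splits)
    have "k_t u r ?m \<le> k"
      using ge[of ?m] 3(1) assms(3) by (cases "?m = 0") (auto simp: k_t_def)
    moreover have "?m + 1 \<le> k_t u r ?m"
      by (simp add: k_t_def)
    \<comment> \<open>Here \<open>r \<le> 2 * ?m + 2\<close>, so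
      \<open>?m + 1 \<le> k < r - ?m\<close> leaves a single value of \<open>k\<close>.\<close>
    ultimately have "k_t u r ?m = k" "k = r - (?m + 1)"
      using 3(2) m assms(1) by linarith+
    then have "(k, l) \<in> A_set u r (?m + 1)"
      using 3(1) assms(6) by (simp add: A_set_def)
    then show ?thesis
      using is_table_entry.A[of "?m + 1" u r k l] by auto
  qed
qed

theorem corollary4p2:
  fixes u r k l :: nat and w :: "letter list"
  assumes "2 \<le> r" and "r < u"
    and "1 \<le> k" and "k \<le> r - 1"
    and "1 \<le> l" and "l \<le> u - r"
  defines "w \<equiv> replicate (u - r - l) \<alpha> @ replicate l \<beta>
              @ replicate (r - k) \<alpha> @ replicate k \<beta> @ [\<alpha>]"
  shows "(\<exists>!P. is_partition P \<and> burge_code P = w)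
       \<and> table_partition u r k l = burge_partition w"
proof -
  obtain P where P: "is_table_entry u r k l P"
    using is_table_entry_exists[OF assms(1-6)] by blast
  have w: "w = two_block_word r k (u - r) l"
    by (simp add: w_def two_block_word_def)
  have entry: "is_partition R \<and> burge_code R = w" if "is_table_entry u r k l R" for R
    using is_table_entry_burge_code[OF assms(1-6) that] by (simp add: w)
  \<comment> \<open>Injectivity serves three purposes: it settles both definite descriptions and the
    unique existence.\<close>
  have unique: "R = P" if "is_partition R \<and> burge_code R = w" for R
    using burge_code_inj[of R P] that entry[OF P] by simp
  have "table_partition u r k l = P"
    unfolding table_partition_def by (rule the_equality, rule P) (rule unique[OF entry])
  moreover have "burge_partition w = P"
    unfolding burge_partition_def by (rule the_equality, rule entry[OF P]) (rule unique)
  moreover have "\<exists>!P. is_partition P \<and> burge_code P = w"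
    using entry[OF P] unique by (rule ex1I)
  ultimately show ?thesis by simp
qed

end
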